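(* The class of (countably infinite) modal algebras is not punctually robust: there exists a computable modal algebra that is not isomorphic to any punctual modal algebra.
   Context: Boolean algebras are considered in the signature $\{\cup,\cap,\mathrm C,0,1\}$. A modal algebra is a structure $(\mathcal B,f)$ where $\mathcal B$ is a Boolean algebra and $f\colon\mathcal B\to\mathcal B$ is a modality, i.e. $f(a\cup b)=f(a)\cup f(b)$ for all $a,b$ and $f(0)=0$. A structure is computable if its domain is a computable subset of $\mathbb N$ and its operations are computable; it is punctual if its domain is $\mathbb N$ and its operations are primitive recursive. A class is punctually robust if every computable member is isomorphic to a punctual structure. *)

theory Defs
  imports Main
begin

text \<open>
  Codes for partial recursive functions. Codes carry no arity: the function of arity \<open>n\<close>
  denoted by a code is its evaluation on argument lists of length \<open>n\<close>, and an ill-formed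
  application is undefined.
\<close>

datatype recf =
    Zero
  | Succ
  | Proj nat
  | Cn recf "recf list"
  | Pr recf recf
  | Mn recf

fun eval :: "recf \<Rightarrow> nat list \<Rightarrow> nat option" where
  "eval Zero xs = Some 0"
| "eval Succ xs = (case xs of [x] \<Rightarrow> Some (Suc x) | _ \<Rightarrow> None)"
| "eval (Proj i) xs = (if i < length xs then Some (xs ! i) else None)"
| "eval (Cn g hs) xs =
    Option.bind (those (map (\<lambda>h. eval h xs) hs)) (\<lambda>ys. eval g ys)"
| "eval (Pr g h) xs =
    (case xs of
      [] \<Rightarrow> None
    | n # ys \<Rightarrow>
        rec_nat (eval g ys) (\<lambda>k r. Option.bind r (\<lambda>y. eval h (k # y # ys))) n)"
| "eval (Mn g) xs =
    (if \<exists>n. eval g (n # xs) = Some 0 \<and> (\<forall>m<n. \<exists>k. eval g (m # xs) = Some (Suc k))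
     then Some (LEAST n. eval g (n # xs) = Some 0)
     else None)"

fun mu_free :: "recf \<Rightarrow> bool" where
  "mu_free Zero \<longleftrightarrow> True"
| "mu_free Succ \<longleftrightarrow> True"
| "mu_free (Proj i) \<longleftrightarrow> True"
| "mu_free (Cn g hs) \<longleftrightarrow> mu_free g \<and> (\<forall>h\<in>set hs. mu_free h)"
| "mu_free (Pr g h) \<longleftrightarrow> mu_free g \<and> mu_free h"
| "mu_free (Mn g) \<longleftrightarrow> False"

definition computable_set :: "nat set \<Rightarrow> bool" where
  "computable_set D \<longleftrightarrow> (\<exists>p. \<forall>x. eval p [x] = Some (if x \<in> D then 1 else 0))"

text \<open>An operation on \<open>D\<close> is computable if some partial recursive function extends it.\<close>

definition computable_op1 :: "nat set \<Rightarrow> (nat \<Rightarrow> nat) \<Rightarrow> bool" where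
  "computable_op1 D f \<longleftrightarrow> (\<exists>p. \<forall>x\<in>D. eval p [x] = Some (f x))"

definition computable_op2 :: "nat set \<Rightarrow> (nat \<Rightarrow> nat \<Rightarrow> nat) \<Rightarrow> bool" where
  "computable_op2 D f \<longleftrightarrow> (\<exists>p. \<forall>x\<in>D. \<forall>y\<in>D. eval p [x, y] = Some (f x y))"

definition primrec_op1 :: "(nat \<Rightarrow> nat) \<Rightarrow> bool" where
  "primrec_op1 f \<longleftrightarrow> (\<exists>p. mu_free p \<and> (\<forall>x. eval p [x] = Some (f x)))"

definition primrec_op2 :: "(nat \<Rightarrow> nat \<Rightarrow> nat) \<Rightarrow> bool" where
  "primrec_op2 f \<longleftrightarrow> (\<exists>p. mu_free p \<and> (\<forall>x y. eval p [x, y] = Some (f x y)))"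

record 'a bool_struct =
  univ :: "'a set"
  join :: "'a \<Rightarrow> 'a \<Rightarrow> 'a"
  meet :: "'a \<Rightarrow> 'a \<Rightarrow> 'a"
  compl :: "'a \<Rightarrow> 'a"
  bzero :: 'a
  bone :: 'a

record 'a modal_struct = "'a bool_struct" +
  modality :: "'a \<Rightarrow> 'a"

locale bool_alg =
  fixes B :: "('a, 'm) bool_struct_scheme"
  assumes join_closed: "\<lbrakk>x \<in> univ B; y \<in> univ B\<rbrakk> \<Longrightarrow> join B x y \<in> univ B"
    and meet_closed: "\<lbrakk>x \<in> univ B; y \<in> univ B\<rbrakk> \<Longrightarrow> meet B x y \<in> univ B"
    and compl_closed: "x \<in> univ B \<Longrightarrow> compl B x \<in> univ B"
    and bzero_closed: "bzero B \<in> univ B"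
    and bone_closed: "bone B \<in> univ B"
    and join_assoc: "\<lbrakk>x \<in> univ B; y \<in> univ B; z \<in> univ B\<rbrakk>
      \<Longrightarrow> join B (join B x y) z = join B x (join B y z)"
    and meet_assoc: "\<lbrakk>x \<in> univ B; y \<in> univ B; z \<in> univ B\<rbrakk>
      \<Longrightarrow> meet B (meet B x y) z = meet B x (meet B y z)"
    and join_comm: "\<lbrakk>x \<in> univ B; y \<in> univ B\<rbrakk> \<Longrightarrow> join B x y = join B y x"
    and meet_comm: "\<lbrakk>x \<in> univ B; y \<in> univ B\<rbrakk> \<Longrightarrow> meet B x y = meet B y x"
    and join_absorb: "\<lbrakk>x \<in> univ B; y \<in> univ B\<rbrakk> \<Longrightarrow> join B x (meet B x y) = x"
    and meet_absorb: "\<lbrakk>x \<in> univ B; y \<in> univ B\<rbrakk> \<Longrightarrow> meet B x (join B x y) = x"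
    and join_distrib: "\<lbrakk>x \<in> univ B; y \<in> univ B; z \<in> univ B\<rbrakk>
      \<Longrightarrow> join B x (meet B y z) = meet B (join B x y) (join B x z)"
    and meet_distrib: "\<lbrakk>x \<in> univ B; y \<in> univ B; z \<in> univ B\<rbrakk>
      \<Longrightarrow> meet B x (join B y z) = join B (meet B x y) (meet B x z)"
    and join_bzero: "x \<in> univ B \<Longrightarrow> join B x (bzero B) = x"
    and meet_bone: "x \<in> univ B \<Longrightarrow> meet B x (bone B) = x"
    and join_compl: "x \<in> univ B \<Longrightarrow> join B x (compl B x) = bone B"
    and meet_compl: "x \<in> univ B \<Longrightarrow> meet B x (compl B x) = bzero B"

locale modal_algebra = bool_alg A for A :: "('a, 'm) modal_struct_scheme" +
  assumes modality_closed: "x \<in> univ A \<Longrightarrow> modality A x \<in> univ A"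
    and modality_join: "\<lbrakk>x \<in> univ A; y \<in> univ A\<rbrakk>
      \<Longrightarrow> modality A (join A x y) = join A (modality A x) (modality A y)"
    and modality_bzero: "modality A (bzero A) = bzero A"

definition modal_iso :: "'a modal_struct \<Rightarrow> 'b modal_struct \<Rightarrow> bool" where
  "modal_iso A B \<longleftrightarrow> (\<exists>h. bij_betw h (univ A) (univ B) \<and>
    (\<forall>x\<in>univ A. \<forall>y\<in>univ A. h (join A x y) = join B (h x) (h y)) \<and>
    (\<forall>x\<in>univ A. \<forall>y\<in>univ A. h (meet A x y) = meet B (h x) (h y)) \<and>
    (\<forall>x\<in>univ A. h (compl A x) = compl B (h x)) \<and>
    h (bzero A) = bzero B \<and>
    h (bone A) = bone B \<and>
    (\<forall>x\<in>univ A. h (modality A x) = modality B (h x)))"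

definition computable_struct :: "nat modal_struct \<Rightarrow> bool" where
  "computable_struct A \<longleftrightarrow>
    computable_set (univ A) \<and>
    computable_op2 (univ A) (join A) \<and>
    computable_op2 (univ A) (meet A) \<and>
    computable_op1 (univ A) (compl A) \<and>
    computable_op1 (univ A) (modality A)"

definition punctual_struct :: "nat modal_struct \<Rightarrow> bool" where
  "punctual_struct A \<longleftrightarrow>
    univ A = UNIV \<and>
    primrec_op2 (join A) \<and>
    primrec_op2 (meet A) \<and>
    primrec_op1 (compl A) \<and>
    primrec_op1 (modality A)"

text \<open>
  Only members with domain contained in the natural numbers can be computable, so a class is
  represented by its members of this form.
\<close>

definition punctually_robust :: "nat modal_struct set \<Rightarrow> bool" where
  "punctually_robust K \<longleftrightarrow>
    (\<forall>A\<in>K. computable_struct A \<longrightarrow> (\<exists>B. punctual_struct B \<and> modal_iso A B))"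

end

theory Submission
  imports Defs "HOL-Library.Nat_Bijection"
begin

text \<open>
  The primitive recursive functions have a computable universal function, so diagonalising gives a
  computable set \<open>S\<close> whose membership problem is not primitive recursive. Let \<open>f\<close> be the modality on
  the finite and cofinite sets of natural numbers induced by the frame in which \<open>n + 1\<close> sees \<open>n\<close>, and
  \<open>n + 2\<close> also sees \<open>n\<close> when \<open>n \<in> S\<close>. The closed terms \<open>f\<^sup>n(1)\<close> denote the final segments \<open>{n..}\<close>,
  so \<open>n \<in> S\<close> can be read off from whether a closed term, uniform in \<open>n\<close>, differs from \<open>0\<close>. In an
  isomorphic punctual algebra this test is primitive recursive, a contradiction.
\<close>

section \<open>Closure properties of recursive functions\<close>

text \<open>The flag separates primitive recursive (\<open>True\<close>) from total recursive
  (\<open>False\<close>), so one set of closure lemmas serves both. The arity is a parameter because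
  codes carry none; on lists of other lengths \<open>f\<close> is arbitrary.\<close>

definition rec_fun :: "bool \<Rightarrow> nat \<Rightarrow> (nat list \<Rightarrow> nat) \<Rightarrow> bool" where
  "rec_fun b n f \<longleftrightarrow>
    (\<exists>p. (b \<longrightarrow> mu_free p) \<and> (\<forall>xs. length xs = n \<longrightarrow> eval p xs = Some (f xs)))"

lemma rec_fun_cong:
  assumes "rec_fun b n f" "\<And>xs. length xs = n \<Longrightarrow> f xs = g xs"
  shows "rec_fun b n g"
  using assms unfolding rec_fun_def by metis

lemma rec_fun_nth: "i < n \<Longrightarrow> rec_fun b n (\<lambda>xs. xs ! i)"
  unfolding rec_fun_def by (rule exI[of _ "Proj i"]) simp

lemma those_map_Some: "those (map (\<lambda>x. Some (f x)) xs) = Some (map f xs)"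
  by (induction xs) auto

lemma rec_fun_comp:
  assumes g: "rec_fun b (length fs) g" and fs: "\<And>f. f \<in> set fs \<Longrightarrow> rec_fun b n f"
  shows "rec_fun b n (\<lambda>xs. g (map (\<lambda>f. f xs) fs))"
proof -
  obtain p where p: "b \<longrightarrow> mu_free p" "\<And>xs. length xs = length fs \<Longrightarrow> eval p xs = Some (g xs)"
    using g unfolding rec_fun_def by blast
  from fs have "\<forall>f\<in>set fs. \<exists>q. (b \<longrightarrow> mu_free q) \<and>
      (\<forall>xs. length xs = n \<longrightarrow> eval q xs = Some (f xs))"
    unfolding rec_fun_def by blast
  then obtain q where q: "\<And>f. f \<in> set fs \<Longrightarrow> b \<longrightarrow> mu_free (q f)"
    "\<And>f xs. \<lbrakk>f \<in> set fs; length xs = n\<rbrakk> \<Longrightarrow> eval (q f) xs = Some (f xs)"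
    by metis
  have "those (map (\<lambda>h. eval h xs) (map q fs)) = Some (map (\<lambda>f. f xs) fs)"
    if "length xs = n" for xs
  proof -
    have "map (\<lambda>h. eval h xs) (map q fs) = map (\<lambda>f. Some (f xs)) fs"
      using q(2) that by simp
    then show ?thesis
      by (simp only: those_map_Some)
  qed
  then show ?thesis
    unfolding rec_fun_def using p q(1)
    by (intro exI[of _ "Cn p (map q fs)"]) auto
qed

lemma rec_fun_comp1:
  assumes "rec_fun b 1 (\<lambda>xs. g (xs ! 0))" "rec_fun b n f"
  shows "rec_fun b n (\<lambda>xs. g (f xs))"
  using rec_fun_comp[of b "[f]" "\<lambda>xs. g (xs ! 0)" n] assms by simp

lemma rec_fun_comp2:
  assumes "rec_fun b 2 (\<lambda>xs. g (xs ! 0) (xs ! 1))" "rec_fun b n f1" "rec_fun b n f2"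
  shows "rec_fun b n (\<lambda>xs. g (f1 xs) (f2 xs))"
  using rec_fun_comp[of b "[f1, f2]" "\<lambda>xs. g (xs ! 0) (xs ! 1)" n] assms
  by (auto simp: numeral_2_eq_2)

text \<open>Recursion arguments and bound variables are placed in front of the parameters; this
  lemma reuses a function of the parameters below such a binder.\<close>

lemma rec_fun_tl:
  assumes "rec_fun b n f"
  shows "rec_fun b (Suc n) (\<lambda>xs. f (tl xs))"
proof -
  let ?fs = "map (\<lambda>i xs. xs ! Suc i) [0..<n]"
  have "rec_fun b (Suc n) (\<lambda>xs. f (map (\<lambda>g. g xs) ?fs))"
    by (rule rec_fun_comp) (use assms in \<open>auto intro: rec_fun_nth\<close>)
  then show ?thesis
    by (rule rec_fun_cong) (auto intro!: arg_cong[of _ _ f] nth_equalityI simp: nth_tl)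
qed

lemma rec_fun_hd: "0 < n \<Longrightarrow> rec_fun b n hd"
  by (rule rec_fun_cong[OF rec_fun_nth[of 0]]) (auto simp: hd_conv_nth)

lemma rec_fun_Suc:
  assumes "rec_fun b n f"
  shows "rec_fun b n (\<lambda>xs. Suc (f xs))"
proof (rule rec_fun_comp1[OF _ assms])
  show "rec_fun b 1 (\<lambda>xs. Suc (xs ! 0))"
    unfolding rec_fun_def by (rule exI[of _ Succ]) (auto simp: length_Suc_conv)
qed

lemma rec_fun_const: "rec_fun b n (\<lambda>_. c)"
proof (induction c)
  case 0
  show ?case
    unfolding rec_fun_def by (rule exI[of _ Zero]) simp
qed (rule rec_fun_Suc)

lemma rec_fun_rec_nat:
  assumes "rec_fun b n g" "rec_fun b (Suc (Suc n)) (\<lambda>xs. h (hd xs) (hd (tl xs)) (tl (tl xs)))"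
    and "rec_fun b n f"
  shows "rec_fun b n (\<lambda>xs. rec_nat (g xs) (\<lambda>k r. h k r xs) (f xs))"
proof -
  obtain p q where p: "b \<longrightarrow> mu_free p" "\<And>xs. length xs = n \<Longrightarrow> eval p xs = Some (g xs)"
    and q: "b \<longrightarrow> mu_free q"
      "\<And>xs. length xs = Suc (Suc n) \<Longrightarrow> eval q xs = Some (h (hd xs) (hd (tl xs)) (tl (tl xs)))"
    using assms(1,2) unfolding rec_fun_def by blast
  have ev: "eval (Pr p q) (m # ys) = Some (rec_nat (g ys) (\<lambda>k r. h k r ys) m)"
    if "length ys = n" for m ys
    using that p(2) q(2) by (induction m) simp_all
  have "rec_fun b (Suc n) (\<lambda>xs. rec_nat (g (tl xs)) (\<lambda>k r. h k r (tl xs)) (hd xs))"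
    unfolding rec_fun_def
  proof (intro exI[of _ "Pr p q"] conjI allI impI)
    fix xs :: "nat list"
    assume "length xs = Suc n"
    then show "eval (Pr p q) xs = Some (rec_nat (g (tl xs)) (\<lambda>k r. h k r (tl xs)) (hd xs))"
      using ev by (cases xs) auto
  qed (use p q in simp)
  \<comment> \<open>The code above recurses on an extra first argument. Supplying
    \<open>f xs\<close> for it, and the projections for the parameters, gives recursion up to
    \<open>f xs\<close>.\<close>
  moreover define fs where "fs = f # map (\<lambda>i xs. xs ! i) [0..<n]"
  ultimately have "rec_fun b n (\<lambda>xs. rec_nat (g (tl (map (\<lambda>f. f xs) fs)))
      (\<lambda>k r. h k r (tl (map (\<lambda>f. f xs) fs))) (hd (map (\<lambda>f. f xs) fs)))"
    by (intro rec_fun_comp) (use assms(3) in \<open>auto intro: rec_fun_nth\<close>)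
  moreover have "map (\<lambda>f. f xs) fs = f xs # xs" if "length xs = n" for xs
    using that by (auto simp: fs_def intro: nth_equalityI)
  ultimately show ?thesis
    by (elim rec_fun_cong) simp
qed

lemma rec_fun_hd_tl: "1 < n \<Longrightarrow> rec_fun b n (\<lambda>xs. hd (tl xs))"
  using rec_fun_tl[OF rec_fun_hd[of "n - 1" b]] by simp

lemma rec_fun_add:
  assumes "rec_fun b n f" "rec_fun b n g"
  shows "rec_fun b n (\<lambda>xs. f xs + g xs)"
proof -
  have "rec_fun b n (\<lambda>xs. rec_nat (g xs) (\<lambda>_ r. Suc r) (f xs))"
    by (intro rec_fun_rec_nat rec_fun_Suc rec_fun_hd_tl assms) simp
  moreover have "rec_nat y (\<lambda>_ r. Suc r) x = x + y" for x y
    by (induction x) auto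
  ultimately show ?thesis
    by simp
qed

lemma rec_fun_mult:
  assumes "rec_fun b n f" "rec_fun b n g"
  shows "rec_fun b n (\<lambda>xs. f xs * g xs)"
proof -
  have "rec_fun b n (\<lambda>xs. rec_nat 0 (\<lambda>_ r. g xs + r) (f xs))"
    by (intro rec_fun_rec_nat rec_fun_const rec_fun_add rec_fun_hd_tl
        rec_fun_tl[OF rec_fun_tl] assms) simp
  moreover have "rec_nat 0 (\<lambda>_ r. y + r) x = x * y" for x y :: nat
    by (induction x) auto
  ultimately show ?thesis
    by simp
qed

lemma rec_fun_power:
  assumes "rec_fun b n f" "rec_fun b n g"
  shows "rec_fun b n (\<lambda>xs. f xs ^ g xs)"
proof -
  have "rec_fun b n (\<lambda>xs. rec_nat 1 (\<lambda>_ r. f xs * r) (g xs))"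
    by (intro rec_fun_rec_nat rec_fun_const rec_fun_mult rec_fun_hd_tl
        rec_fun_tl[OF rec_fun_tl] assms) simp
  moreover have "rec_nat 1 (\<lambda>_ r. x * r) y = x ^ y" for x y :: nat
    by (induction y) auto
  ultimately show ?thesis
    by simp
qed

text \<open>Truncated subtraction iterates the predecessor, which is itself the recursion that
  starts at 0 and returns its counter.\<close>

lemma rec_fun_diff:
  assumes "rec_fun b n f" "rec_fun b n g"
  shows "rec_fun b n (\<lambda>xs. f xs - g xs)"
proof -
  have pred: "rec_fun b m (\<lambda>xs. rec_nat 0 (\<lambda>k _. k) (h xs))" if "rec_fun b m h" for m h
    by (intro rec_fun_rec_nat rec_fun_const rec_fun_hd that) simp
  have "rec_fun b n (\<lambda>xs. rec_nat (f xs) (\<lambda>_ r. rec_nat 0 (\<lambda>k _. k) r) (g xs))"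
    by (rule rec_fun_rec_nat[OF assms(1) _ assms(2)], rule pred, rule rec_fun_hd_tl) simp
  moreover have "rec_nat 0 (\<lambda>k _. k) x = x - 1" for x :: nat
    by (cases x) auto
  moreover have "rec_nat x (\<lambda>_ r. r - 1) y = x - y" for x y :: nat
    by (induction y) auto
  ultimately show ?thesis
    by simp
qed

section \<open>Decidable predicates, minimisation and bounded quantifiers\<close>

abbreviation rec_pred :: "nat \<Rightarrow> (nat list \<Rightarrow> bool) \<Rightarrow> bool" where
  "rec_pred n P \<equiv> rec_fun False n (\<lambda>xs. of_bool (P xs))"

lemma rec_pred_less:
  assumes "rec_fun False n f" "rec_fun False n g"
  shows "rec_pred n (\<lambda>xs. f xs < g xs)"
  by (rule rec_fun_cong[of _ _ "\<lambda>xs. 1 - (1 - (g xs - f xs))"],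
      intro rec_fun_diff rec_fun_const assms) auto

lemma rec_pred_not:
  assumes "rec_pred n P"
  shows "rec_pred n (\<lambda>xs. \<not> P xs)"
  by (rule rec_fun_cong[of _ _ "\<lambda>xs. 1 - of_bool (P xs)"],
      intro rec_fun_diff rec_fun_const assms) auto

lemma rec_pred_conj:
  assumes "rec_pred n P" "rec_pred n Q"
  shows "rec_pred n (\<lambda>xs. P xs \<and> Q xs)"
  by (rule rec_fun_cong[of _ _ "\<lambda>xs. of_bool (P xs) * of_bool (Q xs)"],
      intro rec_fun_mult assms) auto

lemma rec_pred_disj:
  assumes "rec_pred n P" "rec_pred n Q"
  shows "rec_pred n (\<lambda>xs. P xs \<or> Q xs)"
  using rec_pred_not[OF rec_pred_conj[OF assms[THEN rec_pred_not]]] by simp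

lemma rec_pred_imp:
  assumes "rec_pred n P" "rec_pred n Q"
  shows "rec_pred n (\<lambda>xs. P xs \<longrightarrow> Q xs)"
  using rec_pred_disj[OF rec_pred_not[OF assms(1)] assms(2)] by (simp only: imp_conv_disj)

lemma rec_pred_iff:
  assumes "rec_pred n P" "rec_pred n Q"
  shows "rec_pred n (\<lambda>xs. P xs \<longleftrightarrow> Q xs)"
  unfolding iff_conv_conj_imp by (intro rec_pred_conj rec_pred_imp assms)

lemma rec_pred_if:
  assumes "rec_pred n P" "rec_pred n Q" "rec_pred n R"
  shows "rec_pred n (\<lambda>xs. if P xs then Q xs else R xs)"
  unfolding if_bool_eq_conj by (intro rec_pred_conj rec_pred_imp rec_pred_not assms)

lemma rec_pred_eq:
  assumes "rec_fun False n f" "rec_fun False n g"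
  shows "rec_pred n (\<lambda>xs. f xs = g xs)"
proof -
  have "rec_pred n (\<lambda>xs. \<not> f xs < g xs \<and> \<not> g xs < f xs)"
    by (intro rec_pred_conj rec_pred_not rec_pred_less assms)
  then show ?thesis
    by (rule rec_fun_cong) auto
qed

lemma rec_fun_Least:
  assumes P: "rec_pred (Suc n) (\<lambda>xs. P (hd xs) (tl xs))"
    and ex: "\<And>xs. length xs = n \<Longrightarrow> \<exists>i. P i xs"
  shows "rec_fun False n (\<lambda>xs. LEAST i. P i xs)"
proof -
  \<comment> \<open>\<open>Mn\<close> searches for a zero, hence the negated indicator. Its totality
    on lists of the right length keeps all values before the first zero defined and
    positive.\<close>
  obtain p where p: "\<And>xs. length xs = Suc n \<Longrightarrow> eval p xs = Some (of_bool (\<not> P (hd xs) (tl xs)))"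
    using rec_pred_not[OF P] unfolding rec_fun_def by blast
  have "eval (Mn p) xs = Some (LEAST i. P i xs)" if "length xs = n" for xs
  proof -
    let ?L = "LEAST i. P i xs"
    have e: "eval p (i # xs) = Some (of_bool (\<not> P i xs))" for i
      using p[of "i # xs"] that by simp
    have "P ?L xs"
      using LeastI_ex[OF ex[OF that]] .
    then have "eval p (?L # xs) = Some 0"
      by (simp add: e)
    moreover have "\<exists>k. eval p (m # xs) = Some (Suc k)" if "m < ?L" for m
      using not_less_Least[OF that] by (simp add: e)
    moreover have "(LEAST i. eval p (i # xs) = Some 0) = ?L"
      by (simp add: e)
    ultimately show ?thesis
      by (simp only: eval.simps) (metis (lifting))
  qed
  then show ?thesis
    unfolding rec_fun_def by blast
qed

text \<open>A search for a witness is forced to stop at \<open>f xs\<close> by a second disjunct;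
  its result lies below \<open>f xs\<close> exactly when a witness does.\<close>

lemma rec_pred_bex:
  assumes f: "rec_fun False n f" and P: "rec_pred (Suc n) (\<lambda>xs. P (hd xs) (tl xs))"
  shows "rec_pred n (\<lambda>xs. \<exists>i<f xs. P i xs)"
proof -
  have "rec_fun False n (\<lambda>xs. LEAST i. P i xs \<or> \<not> i < f xs)"
    by (rule rec_fun_Least, intro rec_pred_disj rec_pred_not rec_pred_less rec_fun_hd
        rec_fun_tl[OF f] P) auto
  from rec_pred_less[OF this f] show ?thesis
  proof (rule rec_fun_cong)
    fix xs :: "nat list"
    let ?Q = "\<lambda>i. P i xs \<or> \<not> i < f xs"
    have Q: "?Q (Least ?Q)"
      by (rule LeastI[of _ "f xs"]) simp
    have "(Least ?Q < f xs) = (\<exists>i<f xs. P i xs)"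
    proof
      assume "Least ?Q < f xs"
      then show "\<exists>i<f xs. P i xs"
        using Q by blast
    next
      assume "\<exists>i<f xs. P i xs"
      then obtain i where "i < f xs" "P i xs"
        by blast
      then show "Least ?Q < f xs"
        using Least_le[of ?Q i] by linarith
    qed
    then show "of_bool (Least ?Q < f xs) = of_bool (\<exists>i<f xs. P i xs)"
      by simp
  qed
qed

lemma rec_pred_ball:
  assumes f: "rec_fun False n f" and P: "rec_pred (Suc n) (\<lambda>xs. P (hd xs) (tl xs))"
  shows "rec_pred n (\<lambda>xs. \<forall>i<f xs. P i xs)"
  using rec_pred_not[OF rec_pred_bex[OF f rec_pred_not[OF P]]] by simp

lemmas rec_intros =
  rec_fun_hd rec_fun_nth rec_fun_tl[OF rec_fun_nth] rec_fun_tl[OF rec_fun_tl[OF rec_fun_nth]]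
  rec_fun_hd_tl
  rec_fun_Suc rec_fun_const rec_fun_add rec_fun_mult rec_fun_power rec_fun_diff
  rec_pred_less rec_pred_eq rec_pred_not rec_pred_conj rec_pred_disj rec_pred_imp rec_pred_iff
  rec_pred_if rec_pred_bex rec_pred_ball

lemma rec_fun_div:
  assumes "rec_fun False n f" "rec_fun False n g"
  shows "rec_fun False n (\<lambda>xs. f xs div g xs)"
proof (rule rec_fun_comp2[OF _ assms])
  \<comment> \<open>The disjunct for divisor 0 stops the search at once with result 0, in agreement
    with \<open>x div 0 = 0\<close>.\<close>
  have "rec_fun False 2 (\<lambda>xs. LEAST q. xs ! 1 = 0 \<or> xs ! 0 < Suc q * xs ! 1)"
  proof (rule rec_fun_Least)
    show "rec_pred (Suc 2) (\<lambda>xs. tl xs ! 1 = 0 \<or> tl xs ! 0 < Suc (hd xs) * tl xs ! 1)"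
      by (intro rec_intros) simp_all
    show "\<exists>q. xs ! 1 = 0 \<or> xs ! 0 < Suc q * xs ! 1" for xs :: "nat list"
      by (rule exI[of _ "xs ! 0"]) (cases "xs ! 1"; simp)
  qed
  moreover have "(LEAST q. y = 0 \<or> x < Suc q * y) = x div y" for x y :: nat
  proof (rule Least_equality)
    show "y = 0 \<or> x < Suc (x div y) * y"
      using dividend_less_div_times[of y x] by (auto simp: add.commute)
    show "x div y \<le> q" if "y = 0 \<or> x < Suc q * y" for q
      using that by (metis div_by_0 less_Suc_eq_le less_mult_imp_div_less zero_le)
  qed
  ultimately show "rec_fun False 2 (\<lambda>xs. xs ! 0 div xs ! 1)"
    by simp
qed

lemma rec_pred_odd:
  assumes "rec_fun False n f"
  shows "rec_pred n (\<lambda>xs. odd (f xs))"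
proof -
  have "rec_fun False n (\<lambda>xs. f xs - 2 * (f xs div 2))"
    by (intro rec_intros rec_fun_div assms)
  then show ?thesis
    by (rule rec_fun_cong) (simp add: minus_mult_div_eq_mod mod_2_eq_odd)
qed

lemma rec_pred_mem:
  assumes "rec_fun False n f" "rec_fun False n g"
  shows "rec_pred n (\<lambda>xs. f xs \<in> set_decode (g xs))"
  unfolding set_decode_def mem_Collect_eq
  by (intro rec_pred_odd rec_fun_div rec_intros assms)

lemma rec_fun_prod_encode:
  assumes "rec_fun False n f" "rec_fun False n g"
  shows "rec_fun False n (\<lambda>xs. prod_encode (f xs, g xs))"
  unfolding prod_encode_def triangle_def prod.case
  by (intro rec_fun_div rec_intros assms)

section \<open>Projections of the pairing function\<close>

definition pfst :: "nat \<Rightarrow> nat" where "pfst z = fst (prod_decode z)"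
definition psnd :: "nat \<Rightarrow> nat" where "psnd z = snd (prod_decode z)"

lemma pfst_prod_encode [simp]: "pfst (prod_encode (a, b)) = a"
  and psnd_prod_encode [simp]: "psnd (prod_encode (a, b)) = b"
  by (simp_all add: pfst_def psnd_def)

lemma prod_encode_pfst_psnd [simp]: "prod_encode (pfst z, psnd z) = z"
  by (simp add: pfst_def psnd_def)

text \<open>The second component never exceeds the pair, so the inner quantifier of the search can
  be bounded.\<close>

lemma rec_fun_pfst:
  assumes "rec_fun False n f"
  shows "rec_fun False n (\<lambda>xs. pfst (f xs))"
proof (rule rec_fun_comp1[OF _ assms])
  have "rec_fun False 1 (\<lambda>xs. LEAST a. \<exists>b<Suc (xs ! 0). prod_encode (a, b) = xs ! 0)"
  proof (rule rec_fun_Least)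
    show "rec_pred (Suc 1) (\<lambda>xs. \<exists>b<Suc (tl xs ! 0). prod_encode (hd xs, b) = tl xs ! 0)"
      by (intro rec_intros rec_fun_prod_encode) simp_all
    show "\<exists>a. \<exists>b<Suc (xs ! 0). prod_encode (a, b) = xs ! 0" for xs :: "nat list"
      by (metis le_imp_less_Suc le_prod_encode_2 prod_encode_pfst_psnd)
  qed
  moreover have "(LEAST a. \<exists>b<Suc z. prod_encode (a, b) = z) = pfst z" for z
    by (rule Least_equality)
      (auto, metis le_imp_less_Suc le_prod_encode_2 prod_encode_pfst_psnd)
  ultimately show "rec_fun False 1 (\<lambda>xs. pfst (xs ! 0))"
    by simp
qed

lemma rec_fun_psnd:
  assumes "rec_fun False n f"
  shows "rec_fun False n (\<lambda>xs. psnd (f xs))"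
proof (rule rec_fun_comp1[OF _ assms])
  have "rec_fun False 1 (\<lambda>xs. LEAST b. prod_encode (pfst (xs ! 0), b) = xs ! 0)"
  proof (rule rec_fun_Least)
    show "rec_pred (Suc 1) (\<lambda>xs. prod_encode (pfst (tl xs ! 0), hd xs) = tl xs ! 0)"
      by (intro rec_intros rec_fun_prod_encode rec_fun_pfst) simp_all
    show "\<exists>b. prod_encode (pfst (xs ! 0), b) = xs ! 0" for xs :: "nat list"
      by (metis prod_encode_pfst_psnd)
  qed
  moreover have "(LEAST b. prod_encode (pfst z, b) = z) = psnd z" for z
    by (rule Least_equality) (auto, metis order_refl psnd_prod_encode)
  ultimately show "rec_fun False 1 (\<lambda>xs. psnd (xs ! 0))"
    by simp
qed


section \<open>A computable set that is not primitive recursive\<close>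

definition code_tag :: "nat \<Rightarrow> nat" where "code_tag e = pfst e"
definition code_left :: "nat \<Rightarrow> nat" where "code_left e = pfst (psnd e)"
definition code_right :: "nat \<Rightarrow> nat" where "code_right e = psnd (psnd e)"

definition code :: "nat \<Rightarrow> nat \<Rightarrow> nat \<Rightarrow> nat" where
  "code k a b = prod_encode (k, prod_encode (a, b))"

lemma code_sel [simp]:
  "code_tag (code k a b) = k" "code_left (code k a b) = a" "code_right (code k a b) = b"
  by (simp_all add: code_def code_tag_def code_left_def code_right_def)

text \<open>Strict descent is what makes \<open>prim_eval\<close> terminate. It comes from the
  triangular number in \<open>prod_encode\<close>, which is at least the sum of the components; with
  first component 0 it can fail, as 0 is its own second component.\<close>

lemma psnd_less: "0 < pfst e \<Longrightarrow> psnd e < e"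
proof -
  assume "0 < pfst e"
  moreover have "n \<le> triangle n" for n
    by (induction n) auto
  then have "psnd e + pfst e \<le> triangle (pfst e + psnd e)"
    by (metis add.commute)
  moreover have "e = triangle (pfst e + psnd e) + pfst e"
    using prod_encode_pfst_psnd[of e] by (simp add: prod_encode_def)
  ultimately show ?thesis
    by linarith
qed

lemma pfst_le: "pfst z \<le> z" and psnd_le: "psnd z \<le> z"
  using le_prod_encode_1[of "pfst z" "psnd z"] le_prod_encode_2[of "psnd z" "pfst z"] by simp_all

lemma code_left_less: "0 < code_tag e \<Longrightarrow> code_left e < e"
  and code_right_less: "0 < code_tag e \<Longrightarrow> code_right e < e"
  unfolding code_tag_def code_left_def code_right_def
  using pfst_le psnd_le psnd_less le_less_trans by blast+

text \<open>
  Primitive recursive functions as unary functions on numbers coding argument lists by iterated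
  pairing: every number is a code, so no syntax check is needed.
\<close>

function prim_eval :: "nat \<Rightarrow> nat \<Rightarrow> nat" where
  "prim_eval e x =
    (if code_tag e = 1 then Suc x
     else if code_tag e = 2 then pfst x
     else if code_tag e = 3 then psnd x
     else if code_tag e = 4
       then prod_encode (prim_eval (code_left e) x, prim_eval (code_right e) x)
     else if code_tag e = 5 then prim_eval (code_left e) (prim_eval (code_right e) x)
     else if code_tag e = 6
       then rec_nat (prim_eval (code_left e) (psnd x))
         (\<lambda>k r. prim_eval (code_right e) (prod_encode (k, prod_encode (r, psnd x)))) (pfst x)
     else 0)"
  by pat_completeness auto
termination
  by (relation "measure fst") (auto simp: code_left_less code_right_less)

declare prim_eval.simps [simp del]

lemma prim_eval_code:
  "prim_eval (code 0 a b) x = 0"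
  "prim_eval (code (Suc 0) a b) x = Suc x"
  "prim_eval (code 2 a b) x = pfst x"
  "prim_eval (code 3 a b) x = psnd x"
  "prim_eval (code 4 a b) x = prod_encode (prim_eval a x, prim_eval b x)"
  "prim_eval (code 5 a b) x = prim_eval a (prim_eval b x)"
  "prim_eval (code 6 a b) x = rec_nat (prim_eval a (psnd x))
     (\<lambda>k r. prim_eval b (prod_encode (k, prod_encode (r, psnd x)))) (pfst x)"
  by (subst prim_eval.simps, simp)+

text \<open>No length is stored, so \<open>[]\<close> and \<open>[0]\<close> share the code 0. The
  translation below tolerates this because it only claims agreement where \<open>eval\<close> is
  defined.\<close>

fun args_code :: "nat list \<Rightarrow> nat" where
  "args_code [] = 0"
| "args_code (x # xs) = prod_encode (x, args_code xs)"

lemma args_code_nth: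
  "\<exists>e. \<forall>xs. i < length xs \<longrightarrow> prim_eval e (args_code xs) = xs ! i"
proof (induction i)
  case 0
  have "prim_eval (code 2 0 0) (args_code xs) = xs ! 0" if "0 < length xs" for xs
    using that by (cases xs) (auto simp: prim_eval_code)
  then show ?case
    by blast
next
  case (Suc i)
  then obtain e where e: "\<And>xs. i < length xs \<Longrightarrow> prim_eval e (args_code xs) = xs ! i"
    by blast
  have "prim_eval (code 5 e (code 3 0 0)) (args_code xs) = xs ! Suc i" if "Suc i < length xs" for xs
    using that e by (cases xs) (auto simp: prim_eval_code)
  then show ?case
    by blast
qed

text \<open>Every primitive recursive function has an index for \<open>prim_eval\<close>, as the
  diagonal argument requires. The claim is conditional because \<open>eval\<close> is undefined on
  ill-formed applications while \<open>prim_eval\<close> is total.\<close>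

lemma mu_free_imp_prim_eval:
  assumes "mu_free p"
  shows "\<exists>e. \<forall>xs v. eval p xs = Some v \<longrightarrow> prim_eval e (args_code xs) = v"
  using assms
proof (induction p)
  case Zero
  show ?case
    by (rule exI[of _ "code 0 0 0"]) (simp add: prim_eval_code)
next
  case Succ
  show ?case
    by (rule exI[of _ "code 5 (code (Suc 0) 0 0) (code 2 0 0)"])
      (auto simp: prim_eval_code split: list.splits)
next
  case (Proj i)
  show ?case
    using args_code_nth[of i] by (auto split: if_splits)
next
  case (Cn g hs)
  \<comment> \<open>Pairing (tag 4) merges the codes of all the inner functions into one that
    outputs a whole coded argument list; tag 5 then composes it with \<open>g\<close>.\<close>
  have "\<exists>e. \<forall>xs vs. those (map (\<lambda>h. eval h xs) hs) = Some vs \<longrightarrow>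
      prim_eval e (args_code xs) = args_code vs"
    using Cn.IH(2) Cn.prems
  proof (induction hs)
    case Nil
    show ?case
      by (rule exI[of _ "code 0 0 0"]) (simp add: prim_eval_code)
  next
    case (Cons h hs)
    obtain c d where "\<forall>xs v. eval h xs = Some v \<longrightarrow> prim_eval c (args_code xs) = v"
      "\<forall>xs vs. those (map (\<lambda>h. eval h xs) hs) = Some vs \<longrightarrow>
        prim_eval d (args_code xs) = args_code vs"
      using Cons by (metis list.set_intros(1,2) mu_free.simps(4))
    then show ?case
      by (intro exI[of _ "code 4 c d"]) (auto simp: prim_eval_code split: option.splits)
  qed
  then obtain d where d: "\<And>xs vs. those (map (\<lambda>h. eval h xs) hs) = Some vs \<Longrightarrow>
      prim_eval d (args_code xs) = args_code vs"
    by blast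
  obtain c where "\<And>xs v. eval g xs = Some v \<Longrightarrow> prim_eval c (args_code xs) = v"
    using Cn by auto
  with d show ?case
    by (intro exI[of _ "code 5 c d"]) (auto simp: prim_eval_code bind_eq_Some_conv)
next
  case (Pr g h)
  then obtain c d where c: "\<And>xs v. eval g xs = Some v \<Longrightarrow> prim_eval c (args_code xs) = v"
    and d: "\<And>xs v. eval h xs = Some v \<Longrightarrow> prim_eval d (args_code xs) = v"
    by auto
  \<comment> \<open>Tag 6 passes counter, previous value and parameters as nested pairs, which is
    exactly the coding of the list \<open>k # r # ys\<close>.\<close>
  have "prim_eval (code 6 c d) (args_code (n # ys)) = v"
    if "eval (Pr g h) (n # ys) = Some v" for n ys v
    using that
  proof (induction n arbitrary: v)
    case 0
    then show ?case
      by (simp add: prim_eval_code c)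
  next
    case (Suc n)
    then obtain r where r: "eval (Pr g h) (n # ys) = Some r" "eval h (n # r # ys) = Some v"
      by (auto simp: bind_eq_Some_conv)
    show ?case
      using Suc.IH[OF r(1)] d[OF r(2)] by (simp add: prim_eval_code)
  qed
  then have "prim_eval (code 6 c d) (args_code xs) = v" if "eval (Pr g h) xs = Some v" for xs v
    using that by (cases xs) auto
  then show ?case
    by blast
next
  case (Mn g)
  then show ?case
    by simp
qed

section \<open>Finite certificates for evaluation\<close>

definition triple :: "nat \<Rightarrow> nat \<Rightarrow> nat \<Rightarrow> nat" where
  "triple e x y = prod_encode (e, prod_encode (x, y))"

lemma triple_eq_iff [simp]: "triple e x y = triple e' x' y' \<longleftrightarrow> e = e' \<and> x = x' \<and> y = y'"
  by (simp add: triple_def)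

lemma le_triple: "y \<le> triple e x y"
  unfolding triple_def by (meson le_prod_encode_2 le_trans)

text \<open>Mirrors the clauses of \<open>prim_eval\<close> with each recursive call replaced by a
  lookup in \<open>W\<close>; the recursion of tag 6 is unwound by a single step.\<close>

definition justified :: "nat set \<Rightarrow> nat \<Rightarrow> nat \<Rightarrow> nat \<Rightarrow> bool" where
  "justified W e x y \<longleftrightarrow>
    (if code_tag e = 1 then y = Suc x
     else if code_tag e = 2 then y = pfst x
     else if code_tag e = 3 then y = psnd x
     else if code_tag e = 4
       then triple (code_left e) x (pfst y) \<in> W \<and> triple (code_right e) x (psnd y) \<in> W
     else if code_tag e = 5
       then \<exists>z. triple (code_right e) x z \<in> W \<and> triple (code_left e) z y \<in> W
     else if code_tag e = 6
       then if pfst x = 0 then triple (code_left e) (psnd x) y \<in> W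
         else \<exists>r. triple e (prod_encode (pfst x - 1, psnd x)) r \<in> W \<and>
           triple (code_right e) (prod_encode (pfst x - 1, prod_encode (r, psnd x))) y \<in> W
     else y = 0)"

text \<open>
  A finite certificate set plays the role of a computation tree for \<^const>\<open>prim_eval\<close>. No order on its
  elements is needed because justification always descends in the code or in the recursion argument.
\<close>

definition certificate :: "nat set \<Rightarrow> bool" where
  "certificate W \<longleftrightarrow> (\<forall>e x y. triple e x y \<in> W \<longrightarrow> justified W e x y)"

text \<open>\<open>W\<close> occurs only positively. This lets certificates be joined and
  extended.\<close>

lemma justified_mono: "justified W e x y \<Longrightarrow> W \<subseteq> W' \<Longrightarrow> justified W' e x y"
  unfolding justified_def by (auto split: if_splits)

lemma certificate_Un: "certificate V \<Longrightarrow> certificate W \<Longrightarrow> certificate (V \<union> W)"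
  unfolding certificate_def using justified_mono by (metis Un_iff Un_upper1 Un_upper2)

lemma certificate_insert:
  "certificate W \<Longrightarrow> justified W e x y \<Longrightarrow> certificate (insert (triple e x y) W)"
  unfolding certificate_def using justified_mono by (metis insert_iff subset_insertI triple_eq_iff)

lemma certificate_sound:
  "certificate W \<Longrightarrow> triple e x y \<in> W \<Longrightarrow> y = prim_eval e x"
proof (induction e arbitrary: x y rule: less_induct)
  case (less e)
  have left: "y = prim_eval (code_left e) x"
    if "0 < code_tag e" "triple (code_left e) x y \<in> W" for x y
    using less that code_left_less by blast
  have right: "y = prim_eval (code_right e) x"
    if "0 < code_tag e" "triple (code_right e) x y \<in> W" for x y
    using less that code_right_less by blast
  have just: "justified W e x y" if "triple e x y \<in> W" for x y
    using less that by (simp add: certificate_def)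
  show ?case
  proof (cases "code_tag e = 6")
    case True
    \<comment> \<open>Here the lookup concerns the same code \<open>e\<close>, out of reach of the
      induction on codes, so an inner induction on the recursion argument takes over.\<close>
    have "y = rec_nat (prim_eval (code_left e) u)
         (\<lambda>k r. prim_eval (code_right e) (prod_encode (k, prod_encode (r, u)))) n"
      if "triple e (prod_encode (n, u)) y \<in> W" for n u y
      using that
    proof (induction n arbitrary: y)
      case 0
      then show ?case
        using just[OF 0] left True by (simp add: justified_def)
    next
      case (Suc n)
      then obtain r where "triple e (prod_encode (n, u)) r \<in> W"
        "triple (code_right e) (prod_encode (n, prod_encode (r, u))) y \<in> W"
        using just[OF Suc.prems] True by (auto simp: justified_def)
      with Suc.IH right True show ?case
        by auto
    qed
    from this[of "pfst x" "psnd x"] less.prems True show ?thesis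
      by (subst prim_eval.simps) simp
  next
    case False
    then show ?thesis
      using just[OF less.prems(2)] left[of x "pfst y"] right[of x "psnd y"] left right
      by (subst prim_eval.simps) (auto simp: justified_def split: if_splits)
  qed
qed

lemma certificate_complete:
  "\<exists>W. finite W \<and> certificate W \<and> triple e x (prim_eval e x) \<in> W"
proof (induction e arbitrary: x rule: less_induct)
  case (less e)
  \<comment> \<open>For every tag but 6 it remains to collect a certificate for the recursive calls;
    the triple for \<open>e\<close> itself is inserted on top.\<close>
  have add: ?case
    if "finite W" "certificate W" "justified W e x (prim_eval e x)" for W
    using that certificate_insert[of W e x]
    by (intro exI[of _ "insert (triple e x (prim_eval e x)) W"]) simp
  consider "code_tag e \<notin> {4,5,6}" | "code_tag e = 4" | "code_tag e = 5" | "code_tag e = 6"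
    by blast
  then show ?case
  proof cases
    case 1
    then have "justified {} e x (prim_eval e x)"
      by (subst prim_eval.simps) (auto simp: justified_def)
    then show ?thesis
      by (intro add[of "{}"]) (auto simp: certificate_def)
  next
    case 2
    obtain V where V: "finite V" "certificate V"
      "triple (code_left e) x (prim_eval (code_left e) x) \<in> V"
      using less[OF code_left_less] 2 by force
    obtain W where W: "finite W" "certificate W"
      "triple (code_right e) x (prim_eval (code_right e) x) \<in> W"
      using less[OF code_right_less] 2 by force
    show ?thesis
      by (rule add[of "V \<union> W"], use V W in simp, use V W in \<open>simp add: certificate_Un\<close>,
        subst prim_eval.simps) (use V W 2 in \<open>auto simp: justified_def\<close>)
  next
    case 3
    let ?z = "prim_eval (code_right e) x"
    obtain V where V: "finite V" "certificate V"
      "triple (code_left e) ?z (prim_eval (code_left e) ?z) \<in> V"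
      using less[OF code_left_less] 3 by force
    obtain W where W: "finite W" "certificate W" "triple (code_right e) x ?z \<in> W"
      using less[OF code_right_less] 3 by force
    show ?thesis
      by (rule add[of "V \<union> W"], use V W in simp, use V W in \<open>simp add: certificate_Un\<close>,
        subst prim_eval.simps) (use V W 3 in \<open>auto simp: justified_def\<close>)
  next
    case 4
    define u where "u = psnd x"
    define R where "R = rec_nat (prim_eval (code_left e) u)
      (\<lambda>k r. prim_eval (code_right e) (prod_encode (k, prod_encode (r, u))))"
    \<comment> \<open>For tag 6 the certificate grows along the recursion argument: each step adds a
      certificate for one call of the step function and the new intermediate value
      \<open>R n\<close>.\<close>
    have "\<exists>W. finite W \<and> certificate W \<and> triple e (prod_encode (n, u)) (R n) \<in> W" for n
    proof (induction n)
      case 0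
      obtain W where W: "finite W" "certificate W"
        "triple (code_left e) u (prim_eval (code_left e) u) \<in> W"
        using less[OF code_left_less] 4 by force
      then have "justified W e (prod_encode (0, u)) (R 0)"
        using 4 by (simp add: justified_def R_def)
      then show ?case
        using W certificate_insert
        by (intro exI[of _ "insert (triple e (prod_encode (0, u)) (R 0)) W"]) simp
    next
      case (Suc n)
      then obtain V where V: "finite V" "certificate V" "triple e (prod_encode (n, u)) (R n) \<in> V"
        by blast
      have R: "prim_eval (code_right e) (prod_encode (n, prod_encode (R n, u))) = R (Suc n)"
        by (simp add: R_def)
      obtain W where W: "finite W" "certificate W"
        "triple (code_right e) (prod_encode (n, prod_encode (R n, u))) (R (Suc n)) \<in> W"
        using less[OF code_right_less, of "prod_encode (n, prod_encode (R n, u))"] 4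
        unfolding R by force
      have "justified (V \<union> W) e (prod_encode (Suc n, u)) (R (Suc n))"
        using 4 V W by (auto simp: justified_def)
      then show ?case
        using V W certificate_insert certificate_Un
        by (intro exI[of _ "insert (triple e (prod_encode (Suc n, u)) (R (Suc n))) (V \<union> W)"]) simp
    qed
    from this[of "pfst x"] show ?thesis
      using 4 by (subst prim_eval.simps) (simp add: R_def u_def)
  qed
qed

text \<open>A binary digit at position \<open>t\<close> contributes \<open>2 ^ t\<close>. The bound
  turns quantifiers over members of a coded set into bounded ones.\<close>

lemma mem_set_decode_less: "t \<in> set_decode w \<Longrightarrow> t < w"
proof -
  assume "t \<in> set_decode w"
  then have "w div 2 ^ t \<noteq> 0"
    by (metis even_zero mem_Collect_eq set_decode_def)
  then have "2 ^ t \<le> w"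
    by (metis div_less not_le)
  with less_exp[of t] show ?thesis
    by (rule less_le_trans)
qed

lemma triple_mem_less: "triple e x y \<in> set_decode w \<Longrightarrow> y < w"
  using mem_set_decode_less le_triple le_less_trans by blast

lemma rec_pred_certificate:
  assumes "rec_fun False n f"
  shows "rec_pred n (\<lambda>xs. certificate (set_decode (f xs)))"
proof (rule rec_fun_comp1[OF _ assms])
  \<comment> \<open>\<open>justified\<close> with its existential quantifiers bounded by the code of
    the set: each witness is the last component of a triple in the set, so
    \<open>triple_mem_less\<close> applies.\<close>
  define J where "J w e x y \<longleftrightarrow>
    (if code_tag e = 1 then y = Suc x
     else if code_tag e = 2 then y = pfst x
     else if code_tag e = 3 then y = psnd x
     else if code_tag e = 4
       then triple (code_left e) x (pfst y) \<in> set_decode w \<and>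
         triple (code_right e) x (psnd y) \<in> set_decode w
     else if code_tag e = 5
       then \<exists>z<w. triple (code_right e) x z \<in> set_decode w \<and> triple (code_left e) z y \<in> set_decode w
     else if code_tag e = 6
       then if pfst x = 0 then triple (code_left e) (psnd x) y \<in> set_decode w
         else \<exists>r<w. triple e (prod_encode (pfst x - 1, psnd x)) r \<in> set_decode w \<and>
           triple (code_right e) (prod_encode (pfst x - 1, prod_encode (r, psnd x))) y \<in> set_decode w
     else y = 0)" for w e x y
  have "justified (set_decode w) e x y \<longleftrightarrow> J w e x y" for w e x y
    unfolding justified_def J_def using triple_mem_less by (simp split: if_split) blast
  \<comment> \<open>Every number is a triple, so one quantifier over numbers suffices.\<close>
  moreover have "certificate W \<longleftrightarrow>
      (\<forall>t. t \<in> W \<longrightarrow> justified W (pfst t) (pfst (psnd t)) (psnd (psnd t)))" for W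
    unfolding certificate_def triple_def
    by (metis pfst_prod_encode prod_encode_pfst_psnd psnd_prod_encode)
  ultimately have "certificate (set_decode w) \<longleftrightarrow>
      (\<forall>t<w. t \<in> set_decode w \<longrightarrow> J w (pfst t) (pfst (psnd t)) (psnd (psnd t)))" for w
    using mem_set_decode_less by (simp only:) blast
  moreover have "rec_pred 1 (\<lambda>xs. \<forall>t<xs ! 0. t \<in> set_decode (xs ! 0) \<longrightarrow>
      J (xs ! 0) (pfst t) (pfst (psnd t)) (psnd (psnd t)))"
    unfolding J_def triple_def code_tag_def code_left_def code_right_def
    by (intro rec_intros rec_pred_mem rec_fun_prod_encode rec_fun_pfst rec_fun_psnd) simp_all
  ultimately show "rec_pred 1 (\<lambda>xs. certificate (set_decode (xs ! 0)))"
    by (simp only:)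
qed

section \<open>The diagonal set\<close>

definition diag_set :: "nat set" where
  "diag_set = {e. prim_eval e (args_code [e]) = 0}"

text \<open>Search for a certificate that contains some value of program \<open>e\<close> at
  \<open>[e]\<close>, then look up whether that value is 0. Completeness makes the search succeed;
  soundness makes the answer independent of the certificate found.\<close>

lemma rec_pred_diag_set:
  assumes "rec_fun False n f"
  shows "rec_pred n (\<lambda>xs. f xs \<in> diag_set)"
proof (rule rec_fun_comp1[OF _ assms])
  let ?t = "\<lambda>e y. triple e (prod_encode (e, 0)) y"
  let ?P = "\<lambda>e w. certificate (set_decode w) \<and> (\<exists>y<w. ?t e y \<in> set_decode w)"
  have ex: "\<exists>w. ?P e w" for e
  proof -
    obtain W where "finite W" "certificate W"
      "?t e (prim_eval e (prod_encode (e, 0))) \<in> W"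
      using certificate_complete by blast
    then show ?thesis
      using triple_mem_less[of e _ _ "set_encode W"]
      by (intro exI[of _ "set_encode W"]) (auto simp: set_encode_inverse)
  qed
  have "rec_fun False 1 (\<lambda>xs. LEAST w. ?P (xs ! 0) w)"
  proof (rule rec_fun_Least)
    show "rec_pred (Suc 1) (\<lambda>xs. ?P (tl xs ! 0) (hd xs))"
      unfolding triple_def
      by (intro rec_intros rec_pred_certificate rec_pred_mem rec_fun_prod_encode) simp_all
  qed (rule ex)
  then have "rec_pred 1 (\<lambda>xs. ?t (xs ! 0) 0 \<in> set_decode (LEAST w. ?P (xs ! 0) w))"
    unfolding triple_def by (intro rec_intros rec_pred_mem rec_fun_prod_encode) simp_all
  moreover have "?t e 0 \<in> set_decode (LEAST w. ?P e w) \<longleftrightarrow> e \<in> diag_set" for e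
  proof -
    define W where "W = set_decode (LEAST w. ?P e w)"
    obtain y where "certificate W" "?t e y \<in> W"
      using LeastI_ex[OF ex[of e]] unfolding W_def by blast
    moreover from this have "z = prim_eval e (prod_encode (e, 0))" if "?t e z \<in> W" for z
      using certificate_sound that by blast
    ultimately have "?t e 0 \<in> W \<longleftrightarrow> prim_eval e (prod_encode (e, 0)) = 0"
      by metis
    then show ?thesis
      by (simp add: W_def diag_set_def)
  qed
  ultimately show "rec_pred 1 (\<lambda>xs. xs ! 0 \<in> diag_set)"
    by (simp only:)
qed

text \<open>If \<open>e\<close> is an index of \<open>f\<close>, then \<open>f e = 0\<close> holds
  exactly when \<open>e\<close> belongs to \<open>diag_set\<close>, so the zeros of \<open>f\<close>
  cannot be the complement.\<close>

lemma diag_set_not_primrec: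
  assumes "rec_fun True 1 (\<lambda>xs. f (xs ! 0))"
  shows "\<exists>n. (f n = 0) \<noteq> (n \<notin> diag_set)"
proof -
  obtain p where p: "mu_free p" "\<And>x. eval p [x] = Some (f x)"
    using assms unfolding rec_fun_def by (auto simp: length_Suc_conv)
  obtain e where "\<And>xs v. eval p xs = Some v \<Longrightarrow> prim_eval e (args_code xs) = v"
    using mu_free_imp_prim_eval[OF p(1)] by blast
  then have "prim_eval e (args_code [e]) = f e"
    using p(2) by blast
  then show ?thesis
    unfolding diag_set_def by (intro exI[of _ e]) auto
qed

section \<open>The modal algebra\<close>

text \<open>
  Finite and cofinite sets of natural numbers coded by numbers: the last binary digit tells whether
  the remaining digits list the members or the non-members.
\<close>

definition fc_set :: "nat \<Rightarrow> nat set" where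
  "fc_set x = (if even x then set_decode (x div 2) else - set_decode (x div 2))"

text \<open>All binary digits from position \<open>x\<close> on vanish. A code is thus itself a
  computable bound beyond which membership is constant.\<close>

lemma fc_set_eventually: "x \<le> i \<Longrightarrow> i \<in> fc_set x \<longleftrightarrow> odd x"
  using mem_set_decode_less[of i "x div 2"] by (auto simp: fc_set_def)

lemma inj_fc_set: "inj fc_set"
proof (rule injI)
  fix x y
  assume eq: "fc_set x = fc_set y"
  \<comment> \<open>The point \<open>x + y\<close> lies beyond the bounds of both sets.\<close>
  then have parity: "odd x \<longleftrightarrow> odd y"
    using fc_set_eventually[of x "x + y"] fc_set_eventually[of y "x + y"] by simp
  with eq have "set_decode (x div 2) = set_decode (y div 2)"
    by (auto simp: fc_set_def split: if_splits)
  then have "x div 2 = y div 2"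
    by (metis set_decode_inverse)
  with parity show "x = y"
    by (metis bit_eq_rec)
qed

lemma range_fc_set: "range fc_set = {F. finite F \<or> finite (- F)}"
proof (intro equalityI subsetI)
  fix F :: "nat set"
  assume "F \<in> {F. finite F \<or> finite (- F)}"
  then consider "finite F" | "finite (- F)"
    by blast
  then show "F \<in> range fc_set"
  proof cases
    case 1
    then have "F = fc_set (2 * set_encode F)"
      by (simp add: fc_set_def set_encode_inverse)
    then show ?thesis
      by blast
  next
    case 2
    then have "F = fc_set (Suc (2 * set_encode (- F)))"
      by (simp add: fc_set_def set_encode_inverse)
    then show ?thesis
      by blast
  qed
qed (auto simp: fc_set_def)

text \<open>Inverting \<open>fc_set\<close> by a search suits \<open>rec_fun_Least\<close>; by
  injectivity a set has at most one code.\<close>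

definition fc_code :: "nat set \<Rightarrow> nat" where
  "fc_code F = (LEAST x. fc_set x = F)"

lemma fc_set_code: "F \<in> range fc_set \<Longrightarrow> fc_set (fc_code F) = F"
  unfolding fc_code_def by (rule LeastI_ex) auto

lemma rec_pred_fc_set:
  assumes "rec_fun False n f" "rec_fun False n g"
  shows "rec_pred n (\<lambda>xs. f xs \<in> fc_set (g xs))"
proof -
  have "rec_pred n (\<lambda>xs. (f xs \<in> set_decode (g xs div 2)) \<longleftrightarrow> \<not> odd (g xs))"
    by (intro rec_intros rec_pred_mem rec_pred_odd rec_fun_div assms)
  then show ?thesis
    by (rule rec_fun_cong) (auto simp: fc_set_def)
qed

text \<open>Beyond \<open>N xs + z\<close> both \<open>fc_set z\<close> and \<open>F xs\<close> are
  constant, so their equality is decided by finitely many comparisons. The bound \<open>N\<close>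
  also makes \<open>F xs\<close> finite or cofinite, so the search for \<open>z\<close>
  ends.\<close>

lemma rec_fun_fc_code:
  assumes F: "rec_pred (Suc n) (\<lambda>xs. hd xs \<in> F (tl xs))" and N: "rec_fun False n N"
    and const: "\<And>xs i. length xs = n \<Longrightarrow> N xs \<le> i \<Longrightarrow> i \<in> F xs \<longleftrightarrow> N xs \<in> F xs"
  shows "rec_fun False n (\<lambda>xs. fc_code (F xs))"
proof -
  let ?P = "\<lambda>z xs. \<forall>i<Suc (N xs + z). i \<in> fc_set z \<longleftrightarrow> i \<in> F xs"
  have P: "?P z xs \<longleftrightarrow> fc_set z = F xs" if "length xs = n" for z xs
  proof
    assume *: "?P z xs"
    have "i \<in> fc_set z \<longleftrightarrow> i \<in> F xs" for i
    proof (cases "i < Suc (N xs + z)")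
      case False
      have "N xs + z \<in> fc_set z \<longleftrightarrow> N xs + z \<in> F xs"
        using * by blast
      with False show ?thesis
        using fc_set_eventually[of z i] fc_set_eventually[of z "N xs + z"]
          const[OF that, of i] const[OF that, of "N xs + z"] by simp
    qed (use * in blast)
    then show "fc_set z = F xs"
      by blast
  qed simp
  have ex: "\<exists>z. fc_set z = F xs" if "length xs = n" for xs
  proof -
    have "F xs \<subseteq> {..<N xs} \<or> - F xs \<subseteq> {..<N xs}"
      using const[OF that] not_le by blast
    then have "F xs \<in> range fc_set"
      unfolding range_fc_set using finite_subset finite_lessThan by blast
    then show ?thesis
      by auto
  qed
  have "rec_fun False n (\<lambda>xs. LEAST z. ?P z xs)"
  proof (rule rec_fun_Least)
    have "rec_pred (Suc (Suc n)) (\<lambda>xs. hd xs \<in> F (tl (tl xs)))"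
    proof -
      \<comment> \<open>The argument list is the tested point, the candidate code, then the
        parameters; the projections skip the candidate, on which \<open>F\<close> does not
        depend.\<close>
      define fs where "fs = hd # map (\<lambda>i xs :: nat list. xs ! Suc (Suc i)) [0..<n]"
      have "rec_pred (Suc (Suc n))
          (\<lambda>xs. hd (map (\<lambda>f. f xs) fs) \<in> F (tl (map (\<lambda>f. f xs) fs)))"
        by (rule rec_fun_comp) (use F in \<open>auto simp: fs_def intro: rec_fun_nth rec_fun_hd\<close>)
      moreover have "map (\<lambda>f. f xs) fs = hd xs # tl (tl xs)" if "length xs = Suc (Suc n)" for xs
        using that by (auto simp: fs_def nth_tl intro!: nth_equalityI)
      ultimately show ?thesis
        by (elim rec_fun_cong) simp
    qed
    then show "rec_pred (Suc n) (\<lambda>xs. ?P (hd xs) (tl xs))"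
      by (intro rec_pred_ball rec_pred_iff rec_pred_fc_set rec_intros rec_fun_tl[OF N]) simp_all
    show "\<exists>z. ?P z xs" if "length xs = n" for xs
      using ex[OF that] P[OF that] by simp
  qed
  then show ?thesis
    unfolding fc_code_def by (rule rec_fun_cong) (simp add: P)
qed

section \<open>The frame operator and its algebra of finite and cofinite sets\<close>

definition shift :: "nat set \<Rightarrow> nat set \<Rightarrow> nat set" where
  "shift S X = {i. \<exists>j<i. j \<in> X \<and> (i = Suc j \<or> i = Suc (Suc j) \<and> j \<in> S)}"

text \<open>Each point has at most two predecessors in the frame, so finite sets stay finite. The
  edges from \<open>Suc j\<close> to \<open>j\<close> keep the image of a cofinite set
  cofinite.\<close>

lemma shift_range:
  assumes "X \<in> range fc_set"
  shows "shift S X \<in> range fc_set"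
proof -
  have "shift S X \<subseteq> Suc ` X \<union> (\<lambda>j. Suc (Suc j)) ` X"
    by (auto simp: shift_def)
  moreover have "- shift S X \<subseteq> insert 0 (Suc ` (- X))"
  proof
    fix i
    assume "i \<in> - shift S X"
    then show "i \<in> insert 0 (Suc ` (- X))"
      by (cases i) (auto simp: shift_def)
  qed
  ultimately show ?thesis
    using assms unfolding range_fc_set
    by (auto intro: finite_subset)
qed

definition fc_algebra :: "nat set \<Rightarrow> nat modal_struct" where
  "fc_algebra S = \<lparr>univ = UNIV,
    join = \<lambda>x y. fc_code (fc_set x \<union> fc_set y),
    meet = \<lambda>x y. fc_code (fc_set x \<inter> fc_set y),
    compl = \<lambda>x. fc_code (- fc_set x),
    bzero = fc_code {},
    bone = fc_code UNIV,
    modality = \<lambda>x. fc_code (shift S (fc_set x))\<rparr>"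

lemma univ_fc_algebra [simp]: "univ (fc_algebra S) = UNIV"
  by (simp add: fc_algebra_def)

text \<open>Together with the injectivity of \<open>fc_set\<close>, these equations reduce the
  axioms of modal algebras to identities between sets.\<close>

lemma fc_set_ops [simp]:
  "fc_set (join (fc_algebra S) x y) = fc_set x \<union> fc_set y"
  "fc_set (meet (fc_algebra S) x y) = fc_set x \<inter> fc_set y"
  "fc_set (compl (fc_algebra S) x) = - fc_set x"
  "fc_set (bzero (fc_algebra S)) = {}"
  "fc_set (bone (fc_algebra S)) = UNIV"
  "fc_set (modality (fc_algebra S) x) = shift S (fc_set x)"
proof -
  have "fc_set z \<in> {F. finite F \<or> finite (- F)}" for z
    unfolding range_fc_set[symmetric] by (rule rangeI)
  then have "fc_set x \<union> fc_set y \<in> range fc_set" "fc_set x \<inter> fc_set y \<in> range fc_set"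
    "- fc_set x \<in> range fc_set" "{} \<in> range fc_set" "UNIV \<in> range fc_set"
    unfolding range_fc_set by auto
  then show
    "fc_set (join (fc_algebra S) x y) = fc_set x \<union> fc_set y"
    "fc_set (meet (fc_algebra S) x y) = fc_set x \<inter> fc_set y"
    "fc_set (compl (fc_algebra S) x) = - fc_set x"
    "fc_set (bzero (fc_algebra S)) = {}"
    "fc_set (bone (fc_algebra S)) = UNIV"
    "fc_set (modality (fc_algebra S) x) = shift S (fc_set x)"
    by (simp_all add: fc_algebra_def fc_set_code shift_range)
qed

lemma modal_algebra_fc_algebra: "modal_algebra (fc_algebra S)"
proof -
  have "shift S (X \<union> Y) = shift S X \<union> shift S Y" for X Y
    by (auto simp: shift_def)
  moreover have "shift S {} = {}"
    by (simp add: shift_def)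
  ultimately show ?thesis
    by unfold_locales ((simp; fail) | (rule injD[OF inj_fc_set], simp, blast?; fail))+
qed

lemma computable_struct_fc_algebra:
  assumes S: "\<And>n f. rec_fun False n f \<Longrightarrow> rec_pred n (\<lambda>xs. f xs \<in> S)"
  shows "computable_struct (fc_algebra S)"
proof -
  have op1: "computable_op1 UNIV f" if f: "rec_fun False 1 (\<lambda>xs. f (xs ! 0))" for f
  proof -
    obtain p where "eval p xs = Some (f (xs ! 0))" if "length xs = 1" for xs
      using f unfolding rec_fun_def by metis
    from this[of "[x]" for x] show ?thesis
      unfolding computable_op1_def by auto
  qed
  have op2: "computable_op2 UNIV f" if f: "rec_fun False 2 (\<lambda>xs. f (xs ! 0) (xs ! 1))" for f
  proof -
    obtain p where "eval p xs = Some (f (xs ! 0) (xs ! 1))" if "length xs = 2" for xs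
      using f unfolding rec_fun_def by metis
    from this[of "[x, y]" for x y] show ?thesis
      unfolding computable_op2_def by auto
  qed
  have "computable_set UNIV"
    unfolding computable_set_def by (rule exI[of _ "Cn Succ [Zero]"]) simp
  moreover have "computable_op2 UNIV (join (fc_algebra S))"
    unfolding fc_algebra_def bool_struct.simps
  proof (rule op2, rule rec_fun_fc_code[where N = "\<lambda>xs. xs ! 0 + xs ! 1"])
    show "rec_pred (Suc 2) (\<lambda>xs. hd xs \<in> fc_set (tl xs ! 0) \<union> fc_set (tl xs ! 1))"
      unfolding Un_iff by (intro rec_intros rec_pred_fc_set) simp_all
    show "rec_fun False 2 (\<lambda>xs. xs ! 0 + xs ! 1)"
      by (intro rec_intros) simp_all
  qed (simp add: fc_set_eventually)
  moreover have "computable_op2 UNIV (meet (fc_algebra S))"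
    unfolding fc_algebra_def bool_struct.simps
  proof (rule op2, rule rec_fun_fc_code[where N = "\<lambda>xs. xs ! 0 + xs ! 1"])
    show "rec_pred (Suc 2) (\<lambda>xs. hd xs \<in> fc_set (tl xs ! 0) \<inter> fc_set (tl xs ! 1))"
      unfolding Int_iff by (intro rec_intros rec_pred_fc_set) simp_all
    show "rec_fun False 2 (\<lambda>xs. xs ! 0 + xs ! 1)"
      by (intro rec_intros) simp_all
  qed (simp add: fc_set_eventually)
  moreover have "computable_op1 UNIV (compl (fc_algebra S))"
    unfolding fc_algebra_def bool_struct.simps
  proof (rule op1, rule rec_fun_fc_code[where N = "\<lambda>xs. xs ! 0"])
    show "rec_pred (Suc 1) (\<lambda>xs. hd xs \<in> - fc_set (tl xs ! 0))"
      unfolding Compl_iff by (intro rec_intros rec_pred_fc_set) simp_all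
    show "rec_fun False 1 (\<lambda>xs. xs ! 0)"
      by (intro rec_intros) simp_all
  qed (simp add: fc_set_eventually)
  moreover have "computable_op1 UNIV (modality (fc_algebra S))"
    unfolding fc_algebra_def modal_struct.simps
  proof (rule op1, rule rec_fun_fc_code[where N = "\<lambda>xs. xs ! 0 + 2"])
    show "rec_pred (Suc 1) (\<lambda>xs. hd xs \<in> shift S (fc_set (tl xs ! 0)))"
      \<comment> \<open>The bound \<open>j < i\<close> in \<open>shift\<close> makes this a bounded
        search, and decidability of \<open>S\<close> enters here.\<close>
      unfolding shift_def mem_Collect_eq by (intro rec_intros rec_pred_fc_set S) simp_all
    show "rec_fun False 1 (\<lambda>xs. xs ! 0 + 2)"
      by (intro rec_intros) simp_all
    \<comment> \<open>The offset 2 puts both possible successors \<open>i - 1\<close> and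
      \<open>i - 2\<close> in the range where \<open>fc_set x\<close> is constant.\<close>
    have "i \<in> shift S (fc_set x) \<longleftrightarrow> odd x" if "x + 2 \<le> i" for i x
    proof -
      define j where "j = i - 2"
      have "i = Suc (Suc j)" "x \<le> j"
        using that by (simp_all add: j_def)
      then show ?thesis
        using fc_set_eventually[of x j] fc_set_eventually[of x "Suc j"]
        by (auto simp: shift_def)
    qed
    then show "i \<in> shift S (fc_set (xs ! 0)) \<longleftrightarrow> xs ! 0 + 2 \<in> shift S (fc_set (xs ! 0))"
      if "xs ! 0 + 2 \<le> i" for i and xs :: "nat list"
      using that by simp
  qed
  ultimately show ?thesis
    by (simp add: computable_struct_def)
qed

text \<open>
  In the frame, \<open>f\<^sup>n(1) = {n..}\<close>; so \<open>f\<^sup>n(1) - f\<^sup>n\<^sup>+\<^sup>1(1) = {n}\<close>, and \<open>f {n}\<close> meets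
  \<open>{Suc (Suc n)..}\<close> iff \<open>n \<in> S\<close>.
\<close>

definition probe :: "nat modal_struct \<Rightarrow> nat \<Rightarrow> nat" where
  "probe A n = (let a = (modality A ^^ n) (bone A) in
    meet A (modality A (meet A a (compl A (modality A a)))) (modality A (modality A a)))"

lemma probe_fc_algebra: "probe (fc_algebra S) n = bzero (fc_algebra S) \<longleftrightarrow> n \<notin> S"
proof -
  have shift_ge: "shift S {k..} = {Suc k..}" for k
  proof (intro equalityI subsetI)
    fix i
    assume "i \<in> {Suc k..}"
    then show "i \<in> shift S {k..}"
      by (cases i) (auto simp: shift_def)
  qed (auto simp: shift_def)
  have pow: "fc_set ((modality (fc_algebra S) ^^ n) (bone (fc_algebra S))) = {n..}"
    by (induction n) (auto simp: shift_ge)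
  have "{n..} \<inter> - {Suc n..} = {n}"
    by auto
  then have "fc_set (probe (fc_algebra S) n) = shift S {n} \<inter> {Suc (Suc n)..}"
    by (simp add: probe_def Let_def pow shift_ge)
  also have "shift S {n} = insert (Suc n) (if n \<in> S then {Suc (Suc n)} else {})"
    by (auto simp: shift_def)
  also have "\<dots> \<inter> {Suc (Suc n)..} = (if n \<in> S then {Suc (Suc n)} else {})"
    by auto
  finally show ?thesis
    using inj_eq[OF inj_fc_set, of "probe (fc_algebra S) n" "bzero (fc_algebra S)"]
    by (simp split: if_splits)
qed

section \<open>Transfer to punctual copies\<close>

lemma rec_fun_probe:
  assumes "punctual_struct B"
  shows "rec_fun True 1 (\<lambda>xs. probe B (xs ! 0))"
proof -
  have op1: "rec_fun True n (\<lambda>xs. f (g xs))" if "primrec_op1 f" "rec_fun True n g" for f n g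
    by (rule rec_fun_comp1[OF _ that(2)])
      (use that(1) in \<open>auto simp: primrec_op1_def rec_fun_def length_Suc_conv\<close>)
  have op2: "rec_fun True n (\<lambda>xs. f (g xs) (h xs))"
    if "primrec_op2 f" "rec_fun True n g" "rec_fun True n h" for f n g h
    by (rule rec_fun_comp2[OF _ that(2,3)])
      (use that(1) in \<open>auto simp: primrec_op2_def rec_fun_def length_Suc_conv numeral_2_eq_2\<close>)
  note B = assms[unfolded punctual_struct_def]
  have meet: "rec_fun True n (\<lambda>xs. meet B (g xs) (h xs))"
    if "rec_fun True n g" "rec_fun True n h" for n g h
    using B op2 that by blast
  have compl: "rec_fun True n (\<lambda>xs. compl B (g xs))" if "rec_fun True n g" for n g
    using B op1 that by blast
  have modality: "rec_fun True n (\<lambda>xs. modality B (g xs))" if "rec_fun True n g" for n g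
    using B op1 that by blast
  \<comment> \<open>Only the exponent depends on the input: the iterate is a primitive recursion
    from the constant \<open>bone B\<close>, and the rest of \<open>probe\<close> is a fixed term in
    it.\<close>
  have "rec_fun True 1 (\<lambda>xs. rec_nat (bone B) (\<lambda>_ r. modality B r) (xs ! 0))"
    by (intro rec_fun_rec_nat rec_fun_const modality rec_fun_hd_tl rec_fun_nth) simp_all
  moreover have "rec_nat (bone B) (\<lambda>_ r. modality B r) n = (modality B ^^ n) (bone B)" for n
    by (induction n) auto
  ultimately have "rec_fun True 1 (\<lambda>xs. (modality B ^^ (xs ! 0)) (bone B))"
    by simp
  then show ?thesis
    unfolding probe_def Let_def by (intro meet compl modality)
qed

text \<open>An isomorphism preserves the values of closed terms, so \<open>probe B\<close> tests
  membership in \<open>S\<close> just as in the original algebra, but now primitive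
  recursively.\<close>

lemma fc_algebra_not_punctual:
  assumes S: "\<And>f. rec_fun True 1 (\<lambda>xs. f (xs ! 0)) \<Longrightarrow> \<exists>n. (f n = 0) \<noteq> (n \<notin> S)"
    and B: "punctual_struct B"
  shows "\<not> modal_iso (fc_algebra S) B"
proof
  let ?A = "fc_algebra S"
  assume "modal_iso ?A B"
  then obtain h where "inj h"
    and h: "\<And>x y. h (meet ?A x y) = meet B (h x) (h y)" "\<And>x. h (compl ?A x) = compl B (h x)"
      "h (bzero ?A) = bzero B" "h (bone ?A) = bone B"
      "\<And>x. h (modality ?A x) = modality B (h x)"
    unfolding modal_iso_def by (auto simp: bij_betw_def)
  have "h ((modality ?A ^^ n) (bone ?A)) = (modality B ^^ n) (bone B)" for n
    by (induction n) (auto simp: h)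
  then have "h (probe ?A n) = probe B n" for n
    by (simp add: probe_def Let_def h)
  then have probe: "probe B n = bzero B \<longleftrightarrow> n \<notin> S" for n
    using probe_fc_algebra[of S n] inj_eq[OF \<open>inj h\<close>, of "probe ?A n" "bzero ?A"] h(3) by simp
  \<comment> \<open>The number \<open>bzero B\<close> is arbitrary. The two truncated differences
    add up to the distance from it, which is 0 exactly when \<open>probe B\<close> takes that
    value.\<close>
  have "rec_fun True 1 (\<lambda>xs. (probe B (xs ! 0) - bzero B) + (bzero B - probe B (xs ! 0)))"
    by (intro rec_fun_add rec_fun_diff rec_fun_const rec_fun_probe B)
  from S[OF this] show False
    using probe by force
qed

theorem theorem10:
  "\<not> punctually_robust {A. modal_algebra A \<and> infinite (univ A)} \<and>
   (\<exists>A :: nat modal_struct. modal_algebra A \<and> infinite (univ A) \<and> computable_struct A \<and>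
     (\<forall>B :: nat modal_struct. modal_algebra B \<and> punctual_struct B \<longrightarrow> \<not> modal_iso A B))"
proof -
  let ?A = "fc_algebra diag_set"
  have "modal_algebra ?A" "infinite (univ ?A)" "computable_struct ?A"
    by (simp_all add: modal_algebra_fc_algebra computable_struct_fc_algebra rec_pred_diag_set)
  moreover have "\<not> modal_iso ?A B" if "punctual_struct B" for B
    using fc_algebra_not_punctual[OF diag_set_not_primrec that] .
  ultimately show ?thesis
    unfolding punctually_robust_def by blast
qed

end
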